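(* Let $\bm{\mu}=(\mu_1,\dots,\mu_r)$ be a system of probability measures on $\partial\mathbb{D}$ with Carathéodory functions $F_1,\dots,F_r$. Let $\bm{n}=(n_1,\dots,n_r)\in\mathbb{N}^r$ and assume that all $n_j$, $j=1,\dots,r$, are even. Put $\ell_j=n_j/2$, $|\bm{\ell}|=|\bm{n}|/2$, $L=\max_j\ell_j$. Consider the problem of finding Laurent polynomials $\xi_{\bm{n},j}\in\operatorname{span}\{z^k\}_{k=-\ell_j}^{\ell_j-1}$ ($j=1,\dots,r$) and $\upsilon_{\bm{n}}\in\operatorname{span}\{z^k\}_{k=-L}^{L-1}$ such that $$\sum_{j=1}^r\xi_{\bm{n},j}(z)F_j(z)+\upsilon_{\bm{n}}(z)=\mathcal{O}(z^{|\bm{\ell}|}),\ z\to0,\qquad \sum_{j=1}^r\xi_{\bm{n},j}(z)F_j(z)+\upsilon_{\bm{n}}(z)=\mathcal{O}(z^{-|\bm{\ell}|}),\ z\to\infty.$$ This problem has a unique solution $\bm{\xi}_{\bm{n}}=(\xi_{\bm{n},1},\dots,\xi_{\bm{n},r})$ satisfying the normalization $$\sum_{j=1}^r\int\xi_{\bm{n},j}(z)z^{-k}\,d\mu_j(z)=\begin{cases}0,&k=-\frac{|\bm{n}|}{2}+1,\dots,\frac{|\bm{n}|}{2}-1,\\ 1,&k=-\frac{|\bm{n}|}{2},\end{cases}$$ if and only if $\bm{n}$ is $\phi$-normal with respect to $\bm{\mu}$. The solutions $\bm{\xi}_{\bm{n}}$ of the (un-normalized) problem are then multiples of the type I vector of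 $\bm{n}$, i.e. of the vector $(\xi_{\bm{n},1},\dots,\xi_{\bm{n},r})$ defined by requiring $\xi_{\bm{n},j}\in\operatorname{span}\{z^k\}_{k=-\ell_j}^{\ell_j-1}$ for each $j$ together with the relations in the last display.
   Context: $\mathbb{N}=\{0,1,2,\dots\}$; $\partial\mathbb{D}=\{z\in\mathbb{C}:|z|=1\}$; $|\bm{n}|=n_1+\dots+n_r$. The Carathéodory function of $\mu_j$ is $F_j(z)=\int_{\partial\mathbb{D}}\frac{w+z}{w-z}\,d\mu_j(w)$, $z\in\mathbb{C}\setminus\partial\mathbb{D}$. Spans are over $\mathbb{C}$; the span of an empty family is $\{0\}$. For $\bm{n}$ with all components even, $\bm{n}$ is $\phi$-normal with respect to $\bm{\mu}$ if there exists a unique Laurent polynomial of the form $$\phi_{\bm{n}}(z)=z^{|\bm{n}|/2}+\kappa_{|\bm{n}|/2-1}z^{|\bm{n}|/2-1}+\dots+\kappa_{-|\bm{n}|/2}z^{-|\bm{n}|/2}$$ (complex coefficients) satisfying, for every $j=1,\dots,r$, $\int\phi_{\bm{n}}(z)z^{-k}\,d\mu_j(z)=0$ for $k=-n_j/2,-n_j/2+1,\dots,n_j/2-1$ (no condition if $n_j=0$). The index $\bm{0}$ is considered to be normal for any system, with $\phi_{\bm{0}}=1$.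
   Formalization: The formal statement assumes n ≠ 0; for n = 0 all ξ_{n,j} vanish, so the normalization at k = 0 reads 0 = 1 and has no solution, although 0 is φ-normal by convention, and the equivalence fails there. *)

theory Defs
  imports "HOL-Probability.Probability" "HOL-Library.Poly_Mapping" "HOL-Library.Landau_Symbols"
begin

text \<open>Laurent polynomials are finitely supported coefficient families indexed by the
  integer exponents.\<close>

type_synonym laurent_poly = "int \<Rightarrow>\<^sub>0 complex"

definition laurent_eval :: "laurent_poly \<Rightarrow> complex \<Rightarrow> complex" where
  "laurent_eval p z = (\<Sum>k\<in>Poly_Mapping.keys p. Poly_Mapping.lookup p k * z powi k)"

definition laurent_span :: "int set \<Rightarrow> laurent_poly set" where
  "laurent_span K = {p. Poly_Mapping.keys p \<subseteq> K}"

definition caratheodory :: "complex measure \<Rightarrow> complex \<Rightarrow> complex" where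
  "caratheodory M z = (LINT w|M. (w + z) / (w - z))"

text \<open>A system of \<open>r\<close> measures, and a multi-index, are families over a finite index type with
  \<open>r\<close> elements. The definitions below are intended for multi-indices with even components only,
  where \<open>div\<close> is exact division.\<close>

definition half_index :: "('r \<Rightarrow> nat) \<Rightarrow> 'r \<Rightarrow> int" where
  "half_index n j = int (n j div 2)"

definition half_size :: "('r::finite \<Rightarrow> nat) \<Rightarrow> int" where
  "half_size n = int ((\<Sum>j\<in>UNIV. n j) div 2)"

definition half_max :: "('r::finite \<Rightarrow> nat) \<Rightarrow> int" where
  "half_max n = Max (range (half_index n))"

text \<open>For \<open>n = 0\<close> the following holds for every system, with \<open>\<phi> = 1\<close> as the unique witness.\<close>

definition phi_normal :: "('r::finite \<Rightarrow> complex measure) \<Rightarrow> ('r \<Rightarrow> nat) \<Rightarrow> bool" where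
  "phi_normal \<mu> n \<longleftrightarrow>
     (\<exists>!\<phi>. \<phi> \<in> laurent_span {- half_size n..half_size n} \<and>
           Poly_Mapping.lookup \<phi> (half_size n) = 1 \<and>
           (\<forall>j. \<forall>k\<in>{- half_index n j..half_index n j - 1}.
              (LINT z|\<mu> j. laurent_eval \<phi> z * z powi (- k)) = 0))"

definition pade_solution ::
    "('r::finite \<Rightarrow> complex measure) \<Rightarrow> ('r \<Rightarrow> nat) \<Rightarrow> ('r \<Rightarrow> laurent_poly) \<Rightarrow> laurent_poly \<Rightarrow> bool" where
  "pade_solution \<mu> n \<xi> \<upsilon> \<longleftrightarrow>
     (\<forall>j. \<xi> j \<in> laurent_span {- half_index n j..half_index n j - 1}) \<and>
     \<upsilon> \<in> laurent_span {- half_max n..half_max n - 1} \<and>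
     (\<lambda>z. (\<Sum>j\<in>UNIV. laurent_eval (\<xi> j) z * caratheodory (\<mu> j) z) + laurent_eval \<upsilon> z)
       \<in> O[at 0](\<lambda>z. z powi half_size n) \<and>
     (\<lambda>z. (\<Sum>j\<in>UNIV. laurent_eval (\<xi> j) z * caratheodory (\<mu> j) z) + laurent_eval \<upsilon> z)
       \<in> O[at_infinity](\<lambda>z. z powi (- half_size n))"

definition type_I_normalized ::
    "('r::finite \<Rightarrow> complex measure) \<Rightarrow> ('r \<Rightarrow> nat) \<Rightarrow> ('r \<Rightarrow> laurent_poly) \<Rightarrow> bool" where
  "type_I_normalized \<mu> n \<xi> \<longleftrightarrow>
     (\<forall>k\<in>{- half_size n + 1..half_size n - 1}.
        (\<Sum>j\<in>UNIV. LINT z|\<mu> j. laurent_eval (\<xi> j) z * z powi (- k)) = 0) \<and>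
     (\<Sum>j\<in>UNIV. LINT z|\<mu> j. laurent_eval (\<xi> j) z * z powi half_size n) = 1"

definition type_I_vector ::
    "('r::finite \<Rightarrow> complex measure) \<Rightarrow> ('r \<Rightarrow> nat) \<Rightarrow> ('r \<Rightarrow> laurent_poly) \<Rightarrow> bool" where
  "type_I_vector \<mu> n \<xi> \<longleftrightarrow>
     (\<forall>j. \<xi> j \<in> laurent_span {- half_index n j..half_index n j - 1}) \<and>
     type_I_normalized \<mu> n \<xi>"

end

theory Submission
  imports Defs
begin

text \<open>Write \<open>c\<^sub>j(m)\<close> for the moment \<open>\<integral> w\<^sup>m d\<mu>\<^sub>j\<close>. The Caratheodory function has the expansion
  \<open>1 + 2 \<Sum> c\<^sub>j(-m) z\<^sup>m\<close> at \<open>0\<close> and \<open>-1 - 2 \<Sum> c\<^sub>j(m) z\<^sup>-\<^sup>m\<close> at \<open>\<infinity>\<close>, so the coefficients of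
  \<open>z\<^sup>k\<close> in the two expansions of \<open>\<Sum> \<xi>\<^sub>j F\<^sub>j\<close> differ by twice \<open>\<Sum> \<integral> \<xi>\<^sub>j z\<^sup>-\<^sup>k d\<mu>\<^sub>j\<close>. Hence a
  suitable \<open>\<upsilon>\<close> exists exactly if these integrals vanish for \<open>\<bar>k\<bar> < \<bar>\<ell>\<bar>\<close>. What remains is linear
  algebra: the square matrix \<open>c\<^sub>j(i - k)\<close> of the type I conditions is the conjugate transpose of the
  matrix of the linear system for the coefficients of \<open>\<phi>\<close>, so the two systems are uniquely solvable
  simultaneously.\<close>

subsection \<open>Square linear systems\<close>

text \<open>Gaussian elimination, one equation at a time: an equation with only zero coefficients is
  dropped, any other one removes a pivot unknown, so the unknowns stay in excess.\<close>

lemma underdetermined_system_nontrivial_solution: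
  fixes M :: "'k \<Rightarrow> 'x \<Rightarrow> 'a::field"
  assumes "finite K" "finite X" "card K < card X"
  shows "\<exists>a. (\<exists>x\<in>X. a x \<noteq> 0) \<and> (\<forall>k\<in>K. (\<Sum>x\<in>X. M k x * a x) = 0)"
  using assms
proof (induction K arbitrary: X M rule: finite_induct)
  case empty
  then obtain x where "x \<in> X" by fastforce
  then show ?case by (intro exI[of _ "\<lambda>_. 1"]) auto
next
  case (insert q K)
  show ?case
  proof (cases "\<exists>p\<in>X. M q p \<noteq> 0")
    case False
    obtain a where "\<exists>x\<in>X. a x \<noteq> 0" "\<forall>k\<in>K. (\<Sum>x\<in>X. M k x * a x) = 0"
      using insert.IH[of X M] insert.prems insert.hyps by auto
    then show ?thesis using False by (intro exI[of _ a]) auto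
  next
    case True
    then obtain p where p: "p \<in> X" "M q p \<noteq> 0" by blast
    define X' where "X' = X - {p}"
    have X': "finite X'" "X = insert p X'" "p \<notin> X'"
      using p insert.prems by (auto simp: X'_def)
    \<comment> \<open>Column \<open>p\<close> is cleared by subtracting a multiple of row
      \<open>q\<close>; \<open>t\<close> below then solves equation \<open>q\<close> for the pivot
      unknown.\<close>
    define M' where "M' k x = M k x - M k p * M q x / M q p" for k x
    obtain a where a: "\<exists>x\<in>X'. a x \<noteq> 0" "\<And>k. k \<in> K \<Longrightarrow> (\<Sum>x\<in>X'. M' k x * a x) = 0"
      using insert.IH[of X' M'] insert.prems insert.hyps X' by auto
    define t where "t = - (\<Sum>x\<in>X'. M q x * a x) / M q p"
    define b where "b = a(p := t)"
    have split: "(\<Sum>x\<in>X. M k x * b x) = M k p * t + (\<Sum>x\<in>X'. M k x * a x)" for k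
    proof -
      have "(\<Sum>x\<in>X'. M k x * b x) = (\<Sum>x\<in>X'. M k x * a x)"
        by (rule sum.cong) (use X' in \<open>auto simp: b_def\<close>)
      then show ?thesis using X' by (simp add: b_def)
    qed
    have "(\<Sum>x\<in>X. M k x * b x) = 0" if "k \<in> K" for k
    proof -
      have "0 = (\<Sum>x\<in>X'. M k x * a x - M k p / M q p * (M q x * a x))"
        using a(2)[OF that] by (simp add: M'_def algebra_simps)
      also have "\<dots> = (\<Sum>x\<in>X'. M k x * a x) + M k p * t"
        by (simp add: sum_subtractf t_def sum_distrib_left sum_divide_distrib)
      finally show ?thesis by (simp add: split add.commute)
    qed
    moreover have "(\<Sum>x\<in>X. M q x * b x) = 0"
      using p by (simp add: split t_def)
    moreover have "\<exists>x\<in>X. b x \<noteq> 0"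
      using a(1) X' by (auto simp: b_def)
    ultimately show ?thesis by (intro exI[of _ b]) auto
  qed
qed

text \<open>Index sets replace matrix dimensions: in the application rows are integers, columns are
  pairs of a component and an exponent, and both ranges depend on \<open>n\<close>.\<close>

definition trivial_kernel :: "'k set \<Rightarrow> 'x set \<Rightarrow> ('k \<Rightarrow> 'x \<Rightarrow> 'a::field) \<Rightarrow> bool" where
  "trivial_kernel K X M \<longleftrightarrow>
     (\<forall>a. (\<forall>k\<in>K. (\<Sum>x\<in>X. M k x * a x) = 0) \<longrightarrow> (\<forall>x\<in>X. a x = 0))"

lemma trivial_kernelD:
  assumes "trivial_kernel K X M" "\<And>k. k \<in> K \<Longrightarrow> (\<Sum>x\<in>X. M k x * a x) = 0" "x \<in> X"
  shows "a x = 0"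
  using assms unfolding trivial_kernel_def by blast

text \<open>Append the column \<open>- b\<close>. The enlarged system has one unknown too many,
  hence a nontrivial solution. Its entry at the new column is nonzero, as the rest would otherwise
  lie in the kernel; dividing by it solves the original system.\<close>

lemma trivial_kernel_imp_solvable:
  fixes M :: "'k \<Rightarrow> 'x \<Rightarrow> 'a::field"
  assumes "finite K" "finite X" "card K = card X" "trivial_kernel K X M"
  shows "\<exists>a. \<forall>k\<in>K. (\<Sum>x\<in>X. M k x * a x) = b k"
proof -
  define Y where "Y = insert None (Some ` X)"
  define N where "N k y = (case y of None \<Rightarrow> - b k | Some x \<Rightarrow> M k x)" for k y
  have "card Y = Suc (card X)"
    using assms(2) by (simp add: Y_def card_image)
  then obtain a where a: "\<exists>y\<in>Y. a y \<noteq> 0" "\<And>k. k \<in> K \<Longrightarrow> (\<Sum>y\<in>Y. N k y * a y) = 0"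
    using underdetermined_system_nontrivial_solution[of K Y N] assms by (auto simp: Y_def)
  have sol: "(\<Sum>x\<in>X. M k x * a (Some x)) = b k * a None" if "k \<in> K" for k
    using a(2)[OF that] assms(2)
    by (simp add: Y_def N_def sum.reindex)
  have "a None \<noteq> 0"
  proof
    assume "a None = 0"
    then have "\<forall>x\<in>X. a (Some x) = 0"
      using trivial_kernelD[OF assms(4), of "\<lambda>x. a (Some x)"] sol by simp
    then show False using a(1) \<open>a None = 0\<close> by (auto simp: Y_def)
  qed
  then show ?thesis
    using sol
    by (intro exI[of _ "\<lambda>x. a (Some x) / a None"]) (simp flip: sum_divide_distrib)
qed

text \<open>The entry \<open>y q\<close> is the pairing of \<open>y\<close> with the unit vector at
  \<open>q\<close>. That vector lies in the image of \<open>M\<close>, which \<open>y\<close>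
  annihilates.\<close>

lemma trivial_kernel_transpose:
  fixes M :: "'k \<Rightarrow> 'x \<Rightarrow> 'a::field"
  assumes "finite K" "finite X" "card K = card X" "trivial_kernel K X M"
  shows "trivial_kernel X K (\<lambda>x k. M k x)"
  unfolding trivial_kernel_def
proof (intro allI impI ballI)
  fix y q assume y: "\<forall>x\<in>X. (\<Sum>k\<in>K. M k x * y k) = 0" and q: "q \<in> K"
  obtain a where a: "\<And>k. k \<in> K \<Longrightarrow> (\<Sum>x\<in>X. M k x * a x) = (if k = q then 1 else 0)"
    using trivial_kernel_imp_solvable[OF assms, of "\<lambda>k. if k = q then 1 else 0"] by blast
  have "y q = (\<Sum>k\<in>K. (if k = q then 1 else 0) * y k)"
    using q assms(1) by (simp add: if_distrib[of "\<lambda>t. t * _"] cong: if_cong)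
  also have "\<dots> = (\<Sum>k\<in>K. (\<Sum>x\<in>X. M k x * a x) * y k)"
    by (rule sum.cong) (simp_all add: a)
  also have "\<dots> = (\<Sum>k\<in>K. \<Sum>x\<in>X. M k x * y k * a x)"
    by (simp add: sum_distrib_right sum_distrib_left mult_ac)
  also have "\<dots> = (\<Sum>x\<in>X. (\<Sum>k\<in>K. M k x * y k) * a x)"
    by (subst sum.swap) (simp add: sum_distrib_right)
  finally show "y q = 0" using y by simp
qed

text \<open>Conjugation carries kernel vectors to kernel vectors of the conjugate matrix; combined
  with transposition this covers the adjoint, the form in which the system for \<phi>
  appears.\<close>

lemma trivial_kernel_cnj_transpose_iff:
  fixes M :: "'k \<Rightarrow> 'x \<Rightarrow> complex"
  assumes "finite K" "finite X" "card K = card X"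
  shows "trivial_kernel X K (\<lambda>x k. cnj (M k x)) \<longleftrightarrow> trivial_kernel K X M"
proof -
  have cnj: "trivial_kernel A B (\<lambda>x y. cnj (N x y))" if "trivial_kernel A B N"
    for A :: "'u set" and B :: "'v set" and N
    unfolding trivial_kernel_def
  proof (intro allI impI)
    fix a assume a: "\<forall>k\<in>A. (\<Sum>x\<in>B. cnj (N k x) * a x) = 0"
    have "(\<Sum>x\<in>B. N k x * cnj (a x)) = cnj (\<Sum>x\<in>B. cnj (N k x) * a x)" for k
      by simp
    then have "(\<Sum>x\<in>B. N k x * cnj (a x)) = 0" if "k \<in> A" for k
      using a that by (metis complex_cnj_zero)
    then have "cnj (a x) = 0" if "x \<in> B" for x
      using trivial_kernelD[OF \<open>trivial_kernel A B N\<close>, of "\<lambda>x. cnj (a x)"] that by blast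
    then show "\<forall>x\<in>B. a x = 0" by simp
  qed
  show ?thesis
    using cnj[OF trivial_kernel_transpose[of K X M]] assms
      trivial_kernel_transpose[of X K "\<lambda>x k. M k x"] cnj[of X K "\<lambda>x k. cnj (M k x)"]
    by auto
qed

subsection \<open>Laurent expansions at the origin\<close>

text \<open>An asymptotic expansion, with no claim of convergence, since the order conditions only
  see remainders. The bound \<open>B\<close> makes every truncation a finite sum; the value of
  \<open>f\<close> at 0 is irrelevant.\<close>

definition laurent_expansion :: "(complex \<Rightarrow> complex) \<Rightarrow> (int \<Rightarrow> complex) \<Rightarrow> bool" where
  "laurent_expansion f e \<longleftrightarrow> (\<exists>B. (\<forall>k<B. e k = 0) \<and>
     (\<forall>s. (\<lambda>z. f z - (\<Sum>k\<in>{B..<s}. e k * z powi k)) \<in> O[at 0](\<lambda>z. z powi s)))"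

lemma powi_bigo_at_0:
  assumes "t \<le> s"
  shows "(\<lambda>z::complex. z powi s) \<in> O[at 0](\<lambda>z::complex. z powi t)"
proof (rule bigoI[where c = 1])
  have "norm (z powi s) \<le> norm (z powi t)" if "z \<noteq> 0" "norm z < 1" for z :: complex
  proof -
    have "z powi s = z powi t * z ^ nat (s - t)"
      using assms that power_int_add[of z t "s - t"] by (simp add: power_int_def[of z "s - t"])
    moreover have "norm (z ^ nat (s - t)) \<le> 1"
      using that by (simp add: norm_power power_le_one)
    ultimately show ?thesis
      by (simp add: norm_mult mult_left_le)
  qed
  moreover have "\<forall>\<^sub>F z in at (0::complex). z \<noteq> 0 \<and> norm z < 1"
    unfolding eventually_at by (intro exI[of _ 1]) auto
  ultimately show "\<forall>\<^sub>F z in at (0::complex). norm (z powi s) \<le> 1 * norm (z powi t)"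
    by (auto elim!: eventually_mono)
qed

lemma powi_not_bigo_at_0: "(\<lambda>z::complex. z powi k) \<notin> O[at 0](\<lambda>z. z powi (k + 1))"
proof
  assume "(\<lambda>z::complex. z powi k) \<in> O[at 0](\<lambda>z. z powi (k + 1))"
  then obtain c where c: "c > 0"
    and ev: "\<forall>\<^sub>F z in at (0::complex). norm (z powi k) \<le> c * norm (z powi (k + 1))"
    by (elim landau_o.bigE)
  have "\<forall>\<^sub>F z in at (0::complex). z \<noteq> 0 \<and> norm z < 1 / c"
    unfolding eventually_at using c by (intro exI[of _ "1 / c"]) auto
  with ev have "\<forall>\<^sub>F z in at (0::complex). False"
  proof eventually_elim
    case (elim z)
    have "norm (z powi k) * 1 \<le> norm (z powi k) * (c * norm z)"
      using elim by (simp add: power_int_add norm_mult mult_ac)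
    moreover have "norm (z powi k) > 0" using elim by simp
    ultimately have "1 \<le> c * norm z" by (simp only: mult_le_cancel_left_pos)
    then show False using elim c by (simp add: field_simps)
  qed
  then show False by simp
qed

lemma laurent_expansionI:
  assumes "\<And>k. k < B \<Longrightarrow> e k = 0"
    and "\<And>N. (\<lambda>z. f z - (\<Sum>k\<in>{B..<B + int N}. e k * z powi k)) \<in> O[at 0](\<lambda>z. z powi (B + int N))"
  shows "laurent_expansion f e"
  unfolding laurent_expansion_def
proof (intro exI[of _ B] conjI allI impI)
  fix s
  show "(\<lambda>z. f z - (\<Sum>k\<in>{B..<s}. e k * z powi k)) \<in> O[at 0](\<lambda>z. z powi s)"
  proof (cases "B \<le> s")
    case True
    then show ?thesis using assms(2)[of "nat (s - B)"] by simp
  next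
    case False
    then show ?thesis
      using assms(2)[of 0] landau_o.big.trans[OF _ powi_bigo_at_0[of s B]] by simp
  qed
qed (use assms(1) in auto)

text \<open>Turns order conditions into equations for coefficients. At a first nonzero
  \<open>e k\<close> with \<open>k < s\<close>, both \<open>f\<close> and
  \<open>f - e k * z powi k\<close> would be of order \<open>z powi (k + 1)\<close>, and hence so
  would \<open>z powi k\<close>.\<close>

lemma laurent_expansion_bigo_iff:
  assumes "laurent_expansion f e"
  shows "f \<in> O[at 0](\<lambda>z. z powi s) \<longleftrightarrow> (\<forall>k<s. e k = 0)"
proof -
  obtain B where B: "\<And>k. k < B \<Longrightarrow> e k = 0"
    and exp: "\<And>s. (\<lambda>z. f z - (\<Sum>k\<in>{B..<s}. e k * z powi k)) \<in> O[at 0](\<lambda>z. z powi s)"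
    using assms by (auto simp: laurent_expansion_def)
  show ?thesis
  proof
    assume "\<forall>k<s. e k = 0"
    then show "f \<in> O[at 0](\<lambda>z. z powi s)" using exp[of s] by simp
  next
    assume f: "f \<in> O[at 0](\<lambda>z. z powi s)"
    have "e k = 0" if "k < s" for k
      using that
    \<comment> \<open>The measure is the distance from \<open>B\<close>; indices below
      \<open>B\<close>, where it collapses to 0, are settled by the choice of
      \<open>B\<close>.\<close>
    proof (induction "nat (k - B)" arbitrary: k rule: less_induct)
      case less
      show ?case
      proof (rule ccontr)
        assume nz: "e k \<noteq> 0"
        then have "B \<le> k" using B by force
        have zero: "e i = 0" if "i < k" for i
          using less.hyps[of i] B[of i] less.prems that \<open>B \<le> k\<close> by (cases "i < B") auto
        have "{B..<k + 1} = insert k {B..<k}" using \<open>B \<le> k\<close> by auto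
        then have "(\<lambda>z. f z - e k * z powi k) \<in> O[at 0](\<lambda>z. z powi (k + 1))"
          using exp[of "k + 1"] zero by simp
        moreover have "f \<in> O[at 0](\<lambda>z. z powi (k + 1))"
          using f powi_bigo_at_0[of "k + 1" s] less.prems by (auto intro: landau_o.big.trans)
        ultimately have "(\<lambda>z. f z - (f z - e k * z powi k)) \<in> O[at 0](\<lambda>z. z powi (k + 1))"
          by (rule sum_in_bigo(2)[rotated])
        then show False using nz powi_not_bigo_at_0[of k] by simp
      qed
    qed
    then show "\<forall>k<s. e k = 0" by blast
  qed
qed

lemma laurent_expansion_zero: "laurent_expansion (\<lambda>_. 0) (\<lambda>_. 0)"
  by (simp add: laurent_expansion_def)

lemma laurent_expansion_add:
  assumes "laurent_expansion f d" "laurent_expansion g e"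
  shows "laurent_expansion (\<lambda>z. f z + g z) (\<lambda>k. d k + e k)"
proof -
  \<comment> \<open>The two expansions may start at different indices; lowering both to
    \<open>min B C\<close> adds only zero terms.\<close>
  have lower: "(\<lambda>z. h z - (\<Sum>k\<in>{C..<s}. c k * z powi k)) \<in> O[at 0](\<lambda>z. z powi s)"
    if "\<And>k. k < B \<Longrightarrow> c k = 0" "C \<le> B"
      "(\<lambda>z. h z - (\<Sum>k\<in>{B..<s}. c k * z powi k)) \<in> O[at 0](\<lambda>z. z powi s)"
    for h :: "complex \<Rightarrow> complex" and c and B C s :: int
  proof -
    have "(\<Sum>k\<in>{C..<s}. c k * z powi k) = (\<Sum>k\<in>{B..<s}. c k * z powi k)" for z
      by (rule sum.mono_neutral_right) (use that in auto)
    then show ?thesis using that by simp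
  qed
  obtain B C where B: "\<And>k. k < B \<Longrightarrow> d k = 0" and C: "\<And>k. k < C \<Longrightarrow> e k = 0"
    and exp: "\<And>s. (\<lambda>z. f z - (\<Sum>k\<in>{B..<s}. d k * z powi k)) \<in> O[at 0](\<lambda>z. z powi s)"
      "\<And>s. (\<lambda>z. g z - (\<Sum>k\<in>{C..<s}. e k * z powi k)) \<in> O[at 0](\<lambda>z. z powi s)"
    using assms by (auto simp: laurent_expansion_def)
  show ?thesis
    unfolding laurent_expansion_def
  proof (intro exI[of _ "min B C"] conjI allI impI)
    fix s
    show "(\<lambda>z. f z + g z - (\<Sum>k\<in>{min B C..<s}. (d k + e k) * z powi k)) \<in> O[at 0](\<lambda>z. z powi s)"
      using sum_in_bigo(1)[OF lower[OF B _ exp(1), of "min B C" s] lower[OF C _ exp(2), of "min B C" s]]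
      by (simp add: sum.distrib algebra_simps)
  qed (use B C in auto)
qed

lemma laurent_expansion_sum:
  assumes "\<And>i. i \<in> S \<Longrightarrow> laurent_expansion (f i) (e i)"
  shows "laurent_expansion (\<lambda>z. \<Sum>i\<in>S. f i z) (\<lambda>k. \<Sum>i\<in>S. e i k)"
  using assms
  by (induction S rule: infinite_finite_induct)
    (auto intro: laurent_expansion_zero laurent_expansion_add)

text \<open>Agreement away from 0 suffices; this matters for functions of \<open>inverse z\<close>,
  since \<open>inverse 0 = 0\<close>.\<close>

lemma laurent_expansion_cong:
  assumes "laurent_expansion f e" "\<And>z. z \<noteq> 0 \<Longrightarrow> f z = g z" "\<And>k. e k = d k"
  shows "laurent_expansion g d"
proof -
  have "e = d" using assms(3) by blast
  have "((\<lambda>z. f z - h z) \<in> O[at 0](G)) = ((\<lambda>z. g z - h z) \<in> O[at 0](G))" for h G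
    by (rule landau_o.big.in_cong) (use assms(2) in \<open>auto simp: eventually_at_filter\<close>)
  then show ?thesis using assms(1) \<open>e = d\<close> by (simp add: laurent_expansion_def)
qed

lemma laurent_expansion_monom_mult:
  assumes "laurent_expansion f e"
  shows "laurent_expansion (\<lambda>z. c * z powi i * f z) (\<lambda>k. c * e (k - i))"
proof -
  obtain B where B: "\<And>k. k < B \<Longrightarrow> e k = 0"
    and exp: "\<And>s. (\<lambda>z. f z - (\<Sum>k\<in>{B..<s}. e k * z powi k)) \<in> O[at 0](\<lambda>z. z powi s)"
    using assms by (auto simp: laurent_expansion_def)
  show ?thesis
    unfolding laurent_expansion_def
  proof (intro exI[of _ "B + i"] conjI allI impI)
    fix s
    have shift: "(\<Sum>k\<in>{B + i..<s}. c * e (k - i) * z powi k)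
        = c * z powi i * (\<Sum>k\<in>{B..<s - i}. e k * z powi k)" if "z \<noteq> 0" for z
      unfolding sum_distrib_left
      by (rule sum.reindex_bij_witness[of _ "\<lambda>k. k + i" "\<lambda>k. k - i"])
        (use that in \<open>auto simp: power_int_diff\<close>)
    \<comment> \<open>Truncating \<open>f\<close> at \<open>s - i\<close> leaves a remainder of
      order \<open>s\<close> after multiplication.\<close>
    have "(\<lambda>z. c * z powi i * (f z - (\<Sum>k\<in>{B..<s - i}. e k * z powi k)))
        \<in> O[at 0](\<lambda>z. z powi i * z powi (s - i))"
      by (intro landau_o.big.mult exp) simp
    also have "?this \<longleftrightarrow> (\<lambda>z. c * z powi i * f z - (\<Sum>k\<in>{B + i..<s}. c * e (k - i) * z powi k))
        \<in> O[at 0](\<lambda>z. z powi s)"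
    proof (rule landau_o.big.cong_ex)
      show "\<forall>\<^sub>F z in at 0. c * z powi i * (f z - (\<Sum>k\<in>{B..<s - i}. e k * z powi k))
          = c * z powi i * f z - (\<Sum>k\<in>{B + i..<s}. c * e (k - i) * z powi k)"
        by (auto simp: eventually_at_filter shift right_diff_distrib)
      show "\<forall>\<^sub>F z in at 0. (z::complex) powi i * z powi (s - i) = z powi s"
        by (auto simp: eventually_at_filter power_int_diff)
    qed
    finally show "(\<lambda>z. c * z powi i * f z - (\<Sum>k\<in>{B + i..<s}. c * e (k - i) * z powi k))
        \<in> O[at 0](\<lambda>z. z powi s)" .
  qed (use B in auto)
qed

lemma laurent_expansion_one: "laurent_expansion (\<lambda>_. 1) (\<lambda>k. if k = 0 then 1 else 0)"
proof (rule laurent_expansionI[of 0])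
  fix N
  \<comment> \<open>For \<open>N = 0\<close> the constant term is cut off and the remainder is 1,
    still of order \<open>z powi 0\<close>.\<close>
  have "(\<Sum>k\<in>{0..<0 + int N}. (if k = 0 then 1 else 0) * z powi k) = (if N = 0 then 0 else 1 :: complex)"
    for z
    by (simp add: if_distrib[of "\<lambda>t. t * _"] cong: if_cong)
  then show "(\<lambda>z. 1 - (\<Sum>k\<in>{0..<0 + int N}. (if k = 0 then 1 else 0) * z powi k))
      \<in> O[at 0](\<lambda>z::complex. z powi (0 + int N))"
    by simp
qed simp

section \<open>Coefficients and expansions of Laurent polynomials\<close>

lemma laurent_spanD: "p \<in> laurent_span S \<Longrightarrow> i \<notin> S \<Longrightarrow> Poly_Mapping.lookup p i = 0"
  by (auto simp: laurent_span_def in_keys_iff)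

lemma laurent_eval_eq_sum:
  assumes "finite S" "p \<in> laurent_span S"
  shows "laurent_eval p z = (\<Sum>i\<in>S. Poly_Mapping.lookup p i * z powi i)"
  unfolding laurent_eval_def
  by (rule sum.mono_neutral_left) (use assms in \<open>auto simp: laurent_span_def in_keys_iff\<close>)

lemma laurent_span_eqI:
  assumes "p \<in> laurent_span S" "q \<in> laurent_span S"
    and "\<And>i. i \<in> S \<Longrightarrow> Poly_Mapping.lookup p i = Poly_Mapping.lookup q i"
  shows "p = q"
  by (rule poly_mapping_eqI) (metis assms laurent_spanD)

definition laurent_of :: "int set \<Rightarrow> (int \<Rightarrow> complex) \<Rightarrow> laurent_poly" where
  "laurent_of S f = Abs_poly_mapping (\<lambda>i. if i \<in> S then f i else 0)"

lemma lookup_laurent_of: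
  assumes "finite S"
  shows "Poly_Mapping.lookup (laurent_of S f) i = (if i \<in> S then f i else 0)"
proof -
  have "finite {i. (if i \<in> S then f i else 0) \<noteq> 0}"
    by (rule finite_subset[OF _ assms]) auto
  then show ?thesis by (simp add: laurent_of_def)
qed

lemma laurent_of_in_span: "finite S \<Longrightarrow> laurent_of S f \<in> laurent_span S"
  by (auto simp: laurent_span_def in_keys_iff lookup_laurent_of split: if_splits)

lemma laurent_expansion_laurent_mult:
  assumes "finite S" "p \<in> laurent_span S" "laurent_expansion f e"
  shows "laurent_expansion (\<lambda>z. laurent_eval p z * f z)
    (\<lambda>k. \<Sum>i\<in>S. Poly_Mapping.lookup p i * e (k - i))"
  unfolding laurent_eval_eq_sum[OF assms(1,2)] sum_distrib_right
  by (intro laurent_expansion_sum laurent_expansion_monom_mult assms)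

text \<open>Serves the behaviour at infinity, studied through \<open>inverse z\<close>: the
  exponents of \<open>p\<close> change sign, hence the index \<open>k + i\<close>.\<close>

lemma laurent_expansion_laurent_inverse_mult:
  assumes "finite S" "p \<in> laurent_span S" "laurent_expansion f e"
  shows "laurent_expansion (\<lambda>z. laurent_eval p (inverse z) * f z)
    (\<lambda>k. \<Sum>i\<in>S. Poly_Mapping.lookup p i * e (k + i))"
proof -
  have "laurent_expansion (\<lambda>z. \<Sum>i\<in>S. Poly_Mapping.lookup p i * z powi (- i) * f z)
      (\<lambda>k. \<Sum>i\<in>S. Poly_Mapping.lookup p i * e (k - (- i)))"
    by (intro laurent_expansion_sum laurent_expansion_monom_mult assms)
  then show ?thesis
    by (simp add: laurent_eval_eq_sum[OF assms(1,2)] sum_distrib_right power_int_minus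
        power_int_inverse)
qed

lemma laurent_expansion_laurent_eval:
  assumes "finite S" "p \<in> laurent_span S"
  shows "laurent_expansion (laurent_eval p) (Poly_Mapping.lookup p)"
    and "laurent_expansion (\<lambda>z. laurent_eval p (inverse z)) (\<lambda>k. Poly_Mapping.lookup p (- k))"
proof -
  have "(\<Sum>i\<in>S. Poly_Mapping.lookup p i * (if k - i = 0 then 1 else 0)) = Poly_Mapping.lookup p k"
    "(\<Sum>i\<in>S. Poly_Mapping.lookup p i * (if k + i = 0 then 1 else 0)) = Poly_Mapping.lookup p (- k)"
    for k
    using assms laurent_spanD[OF assms(2)]
    by (auto simp: if_distrib[of "\<lambda>t. _ * t"] eq_neg_iff_add_eq_0[of k] add_eq_0_iff
        neg_equal_iff_equal[of k] cong: if_cong)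
  then show "laurent_expansion (laurent_eval p) (Poly_Mapping.lookup p)"
    "laurent_expansion (\<lambda>z. laurent_eval p (inverse z)) (\<lambda>k. Poly_Mapping.lookup p (- k))"
    using laurent_expansion_laurent_mult[OF assms laurent_expansion_one]
      laurent_expansion_laurent_inverse_mult[OF assms laurent_expansion_one] by simp_all
qed

lemma bigo_at_infinity_iff:
  fixes f g :: "complex \<Rightarrow> complex"
  shows "f \<in> O[at_infinity](g) \<longleftrightarrow> (\<lambda>z. f (inverse z)) \<in> O[at 0](\<lambda>z. g (inverse z))"
  unfolding at_to_infinity landau_o.big.in_filtermap_iff by simp

text \<open>For \<open>N > 0\<close> the remainder is exactly \<open>2 * q ^ N / (1 - q)\<close>,
  and \<open>norm (1 - q) \<ge> 1 / 2\<close>. The bound depends on \<open>norm q\<close> alone, so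
  it can be integrated over the circle.\<close>

lemma cayley_geometric_remainder:
  fixes q :: complex
  assumes "norm q \<le> 1 / 2"
  shows "norm ((1 + q) / (1 - q) - (\<Sum>k<N. (if k = 0 then 1 else 2) * q ^ k)) \<le> 4 * norm q ^ N"
proof -
  have q1: "q \<noteq> 1" using assms by auto
  have "1 - norm q \<le> norm (1 - q)" using norm_triangle_ineq2[of 1 q] by simp
  then have d: "1 / 2 \<le> norm (1 - q)" using assms by simp
  show ?thesis
  proof (cases N)
    \<comment> \<open>The closed form fails for the empty sum, because the constant coefficient is 1
      and not 2; the quotient is bounded directly.\<close>
    case 0
    have "norm (1 + q) \<le> 2" using norm_triangle_ineq[of 1 q] assms by simp
    also have "2 \<le> 4 * norm (1 - q)" using d by simp
    finally show ?thesis using 0 q1 by (simp add: norm_divide divide_simps)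
  next
    case (Suc n)
    have "(1 + q) / (1 - q) - (\<Sum>k<Suc n. (if k = 0 then 1 else 2) * q ^ k) = 2 * q ^ Suc n / (1 - q)"
      using q1 by (induction n) (auto simp: field_simps)
    then have "norm ((1 + q) / (1 - q) - (\<Sum>k<N. (if k = 0 then 1 else 2) * q ^ k))
        = 2 * norm q ^ N / norm (1 - q)"
      using Suc by (simp add: norm_divide norm_mult norm_power)
    also have "\<dots> \<le> 2 * norm q ^ N / (1 / 2)"
      using d by (intro divide_left_mono) auto
    finally show ?thesis by simp
  qed
qed

subsection \<open>Measures on the unit circle\<close>

definition moment :: "complex measure \<Rightarrow> int \<Rightarrow> complex" where
  "moment M m = (LINT w|M. w powi m)"

definition caratheodory_coeff :: "complex measure \<Rightarrow> int \<Rightarrow> complex" where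
  "caratheodory_coeff M k = (if k < 0 then 0 else if k = 0 then 1 else 2 * moment M (- k))"

text \<open>The sigma-algebra is that of the circle itself, so \<open>space M\<close> is the circle
  and facts about its points hold on the whole space.\<close>

locale circle_measure = prob_space M for M :: "complex measure" +
  assumes sets_M: "sets M = sets (restrict_space borel (sphere 0 1))"
begin

lemma space_M: "space M = sphere 0 1"
  using sets_eq_imp_space_eq[OF sets_M] by (simp add: space_restrict_space)

lemma integrable_continuous_on:
  fixes f :: "complex \<Rightarrow> complex"
  assumes "continuous_on (sphere 0 1) f"
  shows "integrable M f"
proof -
  have "bounded (f ` sphere 0 1)"
    using assms by (intro compact_imp_bounded compact_continuous_image) auto
  then obtain b where "\<And>w. w \<in> sphere 0 1 \<Longrightarrow> norm (f w) \<le> b"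
    unfolding bounded_iff by blast
  moreover have "f \<in> borel_measurable M"
    using borel_measurable_continuous_on_restrict[OF assms] measurable_cong_sets[OF sets_M refl]
    by blast
  ultimately show ?thesis
    by (intro integrable_const_bound[of _ b] AE_I2) (auto simp: space_M)
qed

lemma moment_0: "moment M 0 = 1"
  by (simp add: moment_def prob_space)

text \<open>On the circle \<open>cnj w = inverse w\<close>. This symmetry makes the system for
  \<phi> the adjoint of the type I system.\<close>

lemma cnj_moment: "cnj (moment M m) = moment M (- m)"
proof -
  have "(LINT w|M. cnj (w powi m)) = (LINT w|M. w powi (- m))"
  proof (rule Bochner_Integration.integral_cong)
    fix w assume "w \<in> space M"
    then have "cnj w = inverse w"
      by (auto simp: space_M inverse_complex_def complex_eq_iff cmod_def)
    then show "cnj (w powi m) = w powi (- m)"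
      by (simp add: power_int_minus power_int_inverse)
  qed simp
  then show ?thesis using Bochner_Integration.integral_cnj[of M "\<lambda>w. w powi m"] by (simp only: moment_def)
qed

lemma integrable_powi: "integrable M (\<lambda>w. w powi m)"
  by (rule integrable_continuous_on) (auto intro!: continuous_intros)

lemma integral_laurent_eval:
  assumes "finite S" "p \<in> laurent_span S"
  shows "(LINT z|M. laurent_eval p z * z powi k) = (\<Sum>i\<in>S. Poly_Mapping.lookup p i * moment M (i + k))"
proof -
  have "(LINT z|M. laurent_eval p z * z powi k)
      = (LINT z|M. (\<Sum>i\<in>S. Poly_Mapping.lookup p i * z powi (i + k)))"
  proof (rule Bochner_Integration.integral_cong)
    fix z assume "z \<in> space M"
    then have "z \<noteq> 0" by (auto simp: space_M)
    then show "laurent_eval p z * z powi k = (\<Sum>i\<in>S. Poly_Mapping.lookup p i * z powi (i + k))"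
      by (simp add: laurent_eval_eq_sum[OF assms] sum_distrib_right power_int_add mult.assoc)
  qed simp
  also have "\<dots> = (\<Sum>i\<in>S. Poly_Mapping.lookup p i * moment M (i + k))"
    by (simp add: moment_def integrable_powi)
  finally show ?thesis .
qed

text \<open>With \<open>q = z / g w\<close> the kernel is \<open>(1 + q) / (1 - q)\<close>, and
  \<open>norm q = norm z\<close> uniformly in \<open>w\<close>, so the expansion integrates term by
  term. The choices \<open>g w = w\<close> and \<open>g w = inverse w\<close> give the expansions at
  0 and at infinity.\<close>

lemma laurent_expansion_herglotz:
  assumes g: "continuous_on (sphere 0 1) g" "\<And>w. w \<in> sphere 0 1 \<Longrightarrow> norm (g w) = 1"
  shows "laurent_expansion (\<lambda>z. LINT w|M. (g w + z) / (g w - z))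
    (\<lambda>k. if k < 0 then 0 else if k = 0 then 1 else 2 * (LINT w|M. g w powi (- k)))"
    (is "laurent_expansion ?h ?e")
proof (rule laurent_expansionI[of 0])
  fix N
  have g0: "g w \<noteq> 0" if "w \<in> sphere 0 1" for w using g(2)[OF that] by auto
  have bound: "norm (?h z - (\<Sum>k\<in>{0..<0 + int N}. ?e k * z powi k)) \<le> 4 * norm (z powi (0 + int N))"
    if z: "z \<noteq> 0" "norm z < 1 / 2" for z
  proof -
    define G where "G k w = (if k = 0 then 1 else 2) * (z / g w) ^ k" for k :: nat and w
    have int_G: "integrable M (G k)" for k
      unfolding G_def by (rule integrable_continuous_on) (auto intro!: continuous_intros g simp: g0)
    have gz: "g w \<noteq> z" if "w \<in> sphere 0 1" for w using g(2)[OF that] z by auto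
    have int_h: "integrable M (\<lambda>w. (g w + z) / (g w - z))"
      by (rule integrable_continuous_on) (auto intro!: continuous_intros g dest: gz)
    have eG: "?e (int k) * z powi (int k) = (LINT w|M. G k w)" for k
    proof (cases "k = 0")
      case True
      then show ?thesis by (simp add: G_def prob_space)
    next
      case False
      have "(LINT w|M. G k w) = (LINT w|M. 2 * z ^ k * g w powi (- int k))"
        using False by (simp add: G_def power_divide power_int_minus) (simp add: divide_inverse mult.assoc)
      then show ?thesis using False by simp
    qed
    have "(\<Sum>k\<in>{0..<0 + int N}. ?e k * z powi k) = (\<Sum>k<N. ?e (int k) * z powi (int k))"
      by (rule sum.reindex_bij_witness[of _ int nat]) auto
    also have "\<dots> = (LINT w|M. (\<Sum>k<N. G k w))"
      unfolding eG using int_G by simp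
    finally have "?h z - (\<Sum>k\<in>{0..<0 + int N}. ?e k * z powi k)
        = (LINT w|M. (g w + z) / (g w - z) - (\<Sum>k<N. G k w))"
      using int_h int_G by simp
    also have "norm \<dots> \<le> (LINT w|M. 4 * norm z ^ N)"
    proof (rule Bochner_Integration.integral_norm_bound_integral)
      fix w assume w: "w \<in> space M"
      then have w': "w \<in> sphere 0 1" by (simp add: space_M)
      have n: "norm (z / g w) = norm z" using g(2)[OF w'] by (simp add: norm_divide)
      have "(g w + z) / (g w - z) = (1 + z / g w) / (1 - z / g w)"
        using g0[OF w'] gz[OF w'] by (simp add: field_simps)
      then show "norm ((g w + z) / (g w - z) - (\<Sum>k<N. G k w)) \<le> 4 * norm z ^ N"
        using cayley_geometric_remainder[of "z / g w" N] z n by (simp add: G_def)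
    qed (use int_h int_G in auto)
    finally show ?thesis by (simp add: prob_space norm_power)
  qed
  have "\<forall>\<^sub>F z in at (0::complex). z \<noteq> 0 \<and> norm z < 1 / 2"
    unfolding eventually_at by (intro exI[of _ "1 / 2"]) auto
  then have "\<forall>\<^sub>F z in at 0. norm (?h z - (\<Sum>k\<in>{0..<0 + int N}. ?e k * z powi k))
      \<le> 4 * norm (z powi (0 + int N))"
    by (rule eventually_mono) (rule bound; simp)
  then show "(\<lambda>z. ?h z - (\<Sum>k\<in>{0..<0 + int N}. ?e k * z powi k)) \<in> O[at 0](\<lambda>z. z powi (0 + int N))"
    by (rule bigoI)
qed simp

lemma laurent_expansion_caratheodory: "laurent_expansion (caratheodory M) (caratheodory_coeff M)"
  by (rule laurent_expansion_cong[OF laurent_expansion_herglotz[of "\<lambda>w. w"]])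
    (auto simp: caratheodory_def caratheodory_coeff_def moment_def)

text \<open>Since \<open>(w + 1/z) / (w - 1/z) = - (1/w + z) / (1/w - z)\<close>, the previous
  expansion applies with \<open>inverse\<close>; moments of \<open>1/w\<close> are conjugates of
  moments of \<open>w\<close>.\<close>

lemma laurent_expansion_caratheodory_inverse:
  "laurent_expansion (\<lambda>z. caratheodory M (inverse z)) (\<lambda>k. - cnj (caratheodory_coeff M k))"
proof -
  have eq: "- (LINT w|M. (inverse w + z) / (inverse w - z)) = caratheodory M (inverse z)"
    if z: "z \<noteq> 0" for z
  proof -
    have "(LINT w|M. - ((inverse w + z) / (inverse w - z))) = caratheodory M (inverse z)"
      unfolding caratheodory_def
    proof (rule Bochner_Integration.integral_cong)
      fix w assume "w \<in> space M"
      then have "w \<noteq> 0" by (auto simp: space_M)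
      then have "inverse w + z = z * inverse w * (w + inverse z)"
        "inverse w - z = - (z * inverse w * (w - inverse z))"
        using z by (simp_all add: field_simps)
      then show "- ((inverse w + z) / (inverse w - z)) = (w + inverse z) / (w - inverse z)"
        using z \<open>w \<noteq> 0\<close> by simp
    qed simp
    then show ?thesis by simp
  qed
  have coeff: "cnj (caratheodory_coeff M k)
      = (if k < 0 then 0 else if k = 0 then 1 else 2 * (LINT w|M. inverse w powi (- k)))" for k
    using cnj_moment[of "- k"]
    by (simp add: caratheodory_coeff_def moment_def power_int_minus power_int_inverse
        del: Bochner_Integration.integral_cnj)
  have "laurent_expansion (\<lambda>z. LINT w|M. (inverse w + z) / (inverse w - z))
      (\<lambda>k. cnj (caratheodory_coeff M k))"
    unfolding coeff
    by (rule laurent_expansion_herglotz) (auto intro!: continuous_intros simp: norm_inverse)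
  from laurent_expansion_monom_mult[OF this, of "- 1" 0] show ?thesis
    by (rule laurent_expansion_cong) (auto simp: eq)
qed

text \<open>The gap between the expansions at 0 and at infinity. For \<open>k \<noteq> 0\<close>
  only one summand survives; at \<open>k = 0\<close> both are 1, matching
  \<open>moment M 0 = 1\<close>.\<close>

lemma caratheodory_coeff_add_cnj:
  "caratheodory_coeff M k + cnj (caratheodory_coeff M (- k)) = 2 * moment M (- k)"
  by (auto simp: caratheodory_coeff_def cnj_moment moment_0)

end

subsection \<open>Type I vectors and Pade solutions\<close>

text \<open>The zero index must be excluded: all its spans are trivial, so the value 1 in the
  normalization is out of reach although the index is \<phi>-normal.\<close>

locale circle_system =
  fixes \<mu> :: "'r::finite \<Rightarrow> complex measure" and n :: "'r \<Rightarrow> nat"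
  assumes circle: "\<And>j. circle_measure (\<mu> j)"
    and even_n: "\<And>j. even (n j)"
    and n_nonzero: "\<exists>j. n j \<noteq> 0"
begin

abbreviation exponents :: "'r \<Rightarrow> int set" where
  "exponents j \<equiv> {- half_index n j..half_index n j - 1}"

abbreviation unknowns :: "('r \<times> int) set" where
  "unknowns \<equiv> Sigma UNIV exponents"

text \<open>Besides the type I conditions, this set indexes the free coefficients of \<phi>, whose
  coefficient at \<open>half_size n\<close> is fixed.\<close>

abbreviation equations :: "int set" where
  "equations \<equiv> {- half_size n..half_size n - 1}"

definition in_spans :: "('r \<Rightarrow> laurent_poly) \<Rightarrow> bool" where
  "in_spans \<xi> \<longleftrightarrow> (\<forall>j. \<xi> j \<in> laurent_span (exponents j))"

definition moment_matrix :: "int \<Rightarrow> 'r \<times> int \<Rightarrow> complex" where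
  "moment_matrix k = (\<lambda>(j, i). moment (\<mu> j) (i - k))"

text \<open>Row \<open>k\<close> of the matrix applied to the coefficients; for \<open>\<xi>\<close>
  in the spans it is the sum of integrals in the normalization, by
  \<open>sum_integral_eq_total_moment\<close>.\<close>

definition total_moment :: "('r \<Rightarrow> laurent_poly) \<Rightarrow> int \<Rightarrow> complex" where
  "total_moment \<xi> k = (\<Sum>(j, i)\<in>unknowns. moment_matrix k (j, i) * Poly_Mapping.lookup (\<xi> j) i)"

section \<open>Sizes of the index sets\<close>

lemma half_size_eq_sum: "half_size n = (\<Sum>j\<in>UNIV. half_index n j)"
proof -
  have "(\<Sum>j\<in>UNIV. n j) = 2 * (\<Sum>j\<in>UNIV. n j div 2)"
    unfolding sum_distrib_left by (rule sum.cong) (use even_n in auto)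
  then show ?thesis by (simp add: half_size_def half_index_def)
qed

lemma half_index_nonneg: "0 \<le> half_index n j"
  by (simp add: half_index_def)

lemma half_index_le_max: "half_index n j \<le> half_max n"
  by (simp add: half_max_def)

lemma half_max_le_size: "half_max n \<le> half_size n"
  unfolding half_max_def half_size_eq_sum
  by (auto intro!: member_le_sum half_index_nonneg)

lemma half_max_pos: "0 < half_max n"
proof -
  obtain j where "n j \<noteq> 0" using n_nonzero by blast
  then have "0 < half_index n j"
    using even_n[of j] by (auto simp: half_index_def elim!: evenE)
  then show ?thesis using half_index_le_max[of j] by simp
qed

lemma half_size_pos: "0 < half_size n"
  using half_max_pos half_max_le_size by simp

text \<open>Component \<open>j\<close> contributes \<open>n j\<close> unknowns. Squareness is what
  lets a trivial kernel yield solvability and pass to the adjoint.\<close>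

lemma card_equations_eq_card_unknowns: "card equations = card unknowns"
proof -
  have "int (card unknowns) = (\<Sum>j\<in>UNIV. 2 * half_index n j)"
    by (simp add: card_SigmaI half_index_nonneg)
  also have "\<dots> = 2 * half_size n"
    by (simp add: half_size_eq_sum sum_distrib_left)
  also have "\<dots> = int (card equations)"
    using half_size_pos by simp
  finally show ?thesis by (simp only: of_nat_eq_iff)
qed

lemma finite_unknowns: "finite unknowns"
  by (rule finite_SigmaI) auto

section \<open>Type I and Pade conditions in terms of coefficients\<close>

lemma total_moment_eq:
  "total_moment \<xi> k
    = (\<Sum>j\<in>UNIV. \<Sum>i\<in>exponents j. Poly_Mapping.lookup (\<xi> j) i * moment (\<mu> j) (i - k))"
  unfolding total_moment_def moment_matrix_def
  by (subst sum.Sigma) (auto simp: mult.commute intro!: sum.cong)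

lemma sum_integral_eq_total_moment:
  assumes "in_spans \<xi>"
  shows "(\<Sum>j\<in>UNIV. LINT z|\<mu> j. laurent_eval (\<xi> j) z * z powi (- k)) = total_moment \<xi> k"
  unfolding total_moment_eq
proof (rule sum.cong)
  fix j
  have "\<xi> j \<in> laurent_span (exponents j)" using assms by (simp add: in_spans_def)
  from circle_measure.integral_laurent_eval[OF circle _ this, of j "- k"]
  show "(LINT z|\<mu> j. laurent_eval (\<xi> j) z * z powi (- k))
      = (\<Sum>i\<in>exponents j. Poly_Mapping.lookup (\<xi> j) i * moment (\<mu> j) (i - k))"
    by simp
qed simp

lemma type_I_vector_iff:
  "type_I_vector \<mu> n \<xi> \<longleftrightarrow>
     in_spans \<xi> \<and> (\<forall>k\<in>equations. total_moment \<xi> k = (if k = - half_size n then 1 else 0))"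
proof (cases "in_spans \<xi>")
  case True
  \<comment> \<open>The normalizing condition is the lowest equation; positivity of
    \<open>half_size n\<close> makes the splitting valid.\<close>
  have "equations = insert (- half_size n) {- half_size n + 1..half_size n - 1}"
    using half_size_pos by auto
  then show ?thesis
    using True sum_integral_eq_total_moment[OF True] sum_integral_eq_total_moment[OF True, of "- half_size n"]
    by (auto simp: type_I_vector_def type_I_normalized_def in_spans_def)
qed (auto simp: type_I_vector_def in_spans_def)

text \<open>Both order conditions are read off at 0, the second after substituting
  \<open>inverse z\<close>; there \<open>k\<close> counts powers of \<open>1/z\<close>.\<close>

lemma pade_solution_iff_coeffs:
  "pade_solution \<mu> n \<xi> \<upsilon> \<longleftrightarrow>
     in_spans \<xi> \<and> \<upsilon> \<in> laurent_span {- half_max n..half_max n - 1} \<and>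
     (\<forall>k<half_size n. (\<Sum>j\<in>UNIV. \<Sum>i\<in>exponents j.
        Poly_Mapping.lookup (\<xi> j) i * caratheodory_coeff (\<mu> j) (k - i)) + Poly_Mapping.lookup \<upsilon> k = 0) \<and>
     (\<forall>k<half_size n. (\<Sum>j\<in>UNIV. \<Sum>i\<in>exponents j.
        Poly_Mapping.lookup (\<xi> j) i * - cnj (caratheodory_coeff (\<mu> j) (k + i))) + Poly_Mapping.lookup \<upsilon> (- k) = 0)"
proof (cases "in_spans \<xi> \<and> \<upsilon> \<in> laurent_span {- half_max n..half_max n - 1}")
  case True
  then have \<xi>: "\<xi> j \<in> laurent_span (exponents j)" for j by (simp add: in_spans_def)
  let ?f = "\<lambda>z. (\<Sum>j\<in>UNIV. laurent_eval (\<xi> j) z * caratheodory (\<mu> j) z) + laurent_eval \<upsilon> z"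
  have at_0: "laurent_expansion ?f (\<lambda>k. (\<Sum>j\<in>UNIV. \<Sum>i\<in>exponents j.
        Poly_Mapping.lookup (\<xi> j) i * caratheodory_coeff (\<mu> j) (k - i)) + Poly_Mapping.lookup \<upsilon> k)"
    by (intro laurent_expansion_add laurent_expansion_sum laurent_expansion_laurent_mult \<xi>
        circle_measure.laurent_expansion_caratheodory[OF circle]
        laurent_expansion_laurent_eval(1)[OF _ conjunct2[OF True]]) auto
  have at_inf: "laurent_expansion (\<lambda>z. ?f (inverse z)) (\<lambda>k. (\<Sum>j\<in>UNIV. \<Sum>i\<in>exponents j.
        Poly_Mapping.lookup (\<xi> j) i * - cnj (caratheodory_coeff (\<mu> j) (k + i))) + Poly_Mapping.lookup \<upsilon> (- k))"
    by (intro laurent_expansion_add laurent_expansion_sum laurent_expansion_laurent_inverse_mult \<xi>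
        circle_measure.laurent_expansion_caratheodory_inverse[OF circle]
        laurent_expansion_laurent_eval(2)[OF _ conjunct2[OF True]]) auto
  have "?f \<in> O[at_infinity](\<lambda>z. z powi (- half_size n))
      \<longleftrightarrow> (\<lambda>z. ?f (inverse z)) \<in> O[at 0](\<lambda>z. z powi half_size n)"
    unfolding bigo_at_infinity_iff by (simp add: power_int_minus power_int_inverse)
  then show ?thesis
    using True \<xi> laurent_expansion_bigo_iff[OF at_0] laurent_expansion_bigo_iff[OF at_inf]
    by (simp add: pade_solution_def)
qed (auto simp: pade_solution_def in_spans_def)

text \<open>With \<open>A k\<close> and \<open>- D k\<close> for the coefficients of
  \<open>z powi k\<close> in the two expansions of the sum without \<upsilon>, the order conditions
  force \<upsilon> to be \<open>- A\<close> below \<open>half_size n\<close> and \<open>D\<close>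
  above \<open>- half_size n\<close>. These prescriptions agree on the overlap exactly when the
  moments vanish there.\<close>

lemma ex_pade_solution_iff:
  "(\<exists>\<upsilon>. pade_solution \<mu> n \<xi> \<upsilon>) \<longleftrightarrow>
     in_spans \<xi> \<and> (\<forall>k\<in>{- half_size n + 1..half_size n - 1}. total_moment \<xi> k = 0)"
proof -
  define A where "A k = (\<Sum>j\<in>UNIV. \<Sum>i\<in>exponents j.
      Poly_Mapping.lookup (\<xi> j) i * caratheodory_coeff (\<mu> j) (k - i))" for k
  define D where "D k = (\<Sum>j\<in>UNIV. \<Sum>i\<in>exponents j.
      Poly_Mapping.lookup (\<xi> j) i * cnj (caratheodory_coeff (\<mu> j) (i - k)))" for k
  have AD: "A k + D k = 2 * total_moment \<xi> k" for k
  proof -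
    have "A k + D k = (\<Sum>j\<in>UNIV. \<Sum>i\<in>exponents j. Poly_Mapping.lookup (\<xi> j) i *
        (caratheodory_coeff (\<mu> j) (k - i) + cnj (caratheodory_coeff (\<mu> j) (- (k - i)))))"
      by (simp add: A_def D_def sum.distrib distrib_left)
    also have "\<dots> = 2 * total_moment \<xi> k"
      unfolding circle_measure.caratheodory_coeff_add_cnj[OF circle] by (simp add: total_moment_eq sum_distrib_left mult_ac)
    finally show ?thesis .
  qed
  \<comment> \<open>The Caratheodory functions have no negative powers at 0 and no positive ones at
    infinity. This confines \<open>A\<close> to \<open>k \<ge> - half_max n\<close> and
    \<open>D\<close> to \<open>k < half_max n\<close>, as the span of \<upsilon> demands.\<close>
  have A0: "A k = 0" if "k < - half_max n" for k
    unfolding A_def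
  proof (intro sum.neutral ballI)
    fix j i assume "i \<in> exponents j"
    then have "k - i < 0" using that half_index_le_max[of j] by auto
    then show "Poly_Mapping.lookup (\<xi> j) i * caratheodory_coeff (\<mu> j) (k - i) = 0"
      by (simp add: caratheodory_coeff_def)
  qed
  have D0: "D k = 0" if "half_max n \<le> k" for k
    unfolding D_def
  proof (intro sum.neutral ballI)
    fix j i assume "i \<in> exponents j"
    then have "i - k < 0" using that half_index_le_max[of j] by auto
    then show "Poly_Mapping.lookup (\<xi> j) i * cnj (caratheodory_coeff (\<mu> j) (i - k)) = 0"
      by (simp add: caratheodory_coeff_def)
  qed
  have inf_iff: "(\<forall>k<half_size n. (\<Sum>j\<in>UNIV. \<Sum>i\<in>exponents j.
        Poly_Mapping.lookup (\<xi> j) i * - cnj (caratheodory_coeff (\<mu> j) (k + i))) + Poly_Mapping.lookup \<upsilon> (- k) = 0)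
      \<longleftrightarrow> (\<forall>k>- half_size n. Poly_Mapping.lookup \<upsilon> k = D k)" for \<upsilon>
  proof -
    have "(\<Sum>j\<in>UNIV. \<Sum>i\<in>exponents j.
        Poly_Mapping.lookup (\<xi> j) i * - cnj (caratheodory_coeff (\<mu> j) (k + i))) = - D (- k)" for k
      by (simp add: D_def sum_negf add.commute)
    then have "?thesis \<longleftrightarrow> ((\<forall>k<half_size n. Poly_Mapping.lookup \<upsilon> (- k) = D (- k))
        \<longleftrightarrow> (\<forall>k>- half_size n. Poly_Mapping.lookup \<upsilon> k = D k))"
      by simp
    moreover have "(\<forall>k<half_size n. P (- k)) \<longleftrightarrow> (\<forall>k>- half_size n. P k)" for P :: "int \<Rightarrow> bool"
    proof safe
      fix k assume "\<forall>k<half_size n. P (- k)" "- half_size n < k"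
      then show "P k" using spec[of "\<lambda>k. k < half_size n \<longrightarrow> P (- k)" "- k"] by simp
    qed simp
    ultimately show ?thesis by simp
  qed
  have iff: "pade_solution \<mu> n \<xi> \<upsilon> \<longleftrightarrow>
      in_spans \<xi> \<and> \<upsilon> \<in> laurent_span {- half_max n..half_max n - 1} \<and>
      (\<forall>k<half_size n. A k + Poly_Mapping.lookup \<upsilon> k = 0) \<and>
      (\<forall>k>- half_size n. Poly_Mapping.lookup \<upsilon> k = D k)" for \<upsilon>
    unfolding pade_solution_iff_coeffs inf_iff A_def by (rule refl)
  show ?thesis
  proof safe
    fix \<upsilon> assume "pade_solution \<mu> n \<xi> \<upsilon>"
    then have \<upsilon>: "in_spans \<xi>" "\<And>k. k < half_size n \<Longrightarrow> A k + Poly_Mapping.lookup \<upsilon> k = 0"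
      "\<And>k. - half_size n < k \<Longrightarrow> Poly_Mapping.lookup \<upsilon> k = D k"
      using iff by auto
    show "in_spans \<xi>" by (fact \<upsilon>)
    fix k assume "k \<in> {- half_size n + 1..half_size n - 1}"
    then have "A k + D k = 0" using \<upsilon>(2)[of k] \<upsilon>(3)[of k] by simp
    then show "total_moment \<xi> k = 0" using AD[of k] by simp
  next
    assume span: "in_spans \<xi>"
      and "\<forall>k\<in>{- half_size n + 1..half_size n - 1}. total_moment \<xi> k = 0"
    then have mom: "A k = - D k" if "- half_size n < k" "k < half_size n" for k
      using AD[of k] that by (simp add: eq_neg_iff_add_eq_0)
    define \<upsilon> where "\<upsilon> = laurent_of {- half_max n..half_max n - 1} (\<lambda>k. - A k)"
    have lookup: "Poly_Mapping.lookup \<upsilon> k = (if k \<in> {- half_max n..half_max n - 1} then - A k else 0)" for k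
      by (simp add: \<upsilon>_def lookup_laurent_of)
    \<comment> \<open>Outside the span of \<upsilon>, \<open>A\<close> vanishes on the low side, and
      on the high side \<open>A k = - D k = 0\<close>; the claim for \<open>D\<close> is
      symmetric.\<close>
    have "A k + Poly_Mapping.lookup \<upsilon> k = 0" if "k < half_size n" for k
      using that A0[of k] D0[of k] mom[of k] half_max_pos half_size_pos by (auto simp: lookup)
    moreover have "Poly_Mapping.lookup \<upsilon> k = D k" if "- half_size n < k" for k
      using that A0[of k] D0[of k] mom[of k] half_max_pos half_size_pos half_max_le_size by (auto simp: lookup)
    moreover have "\<upsilon> \<in> laurent_span {- half_max n..half_max n - 1}"
      by (simp add: \<upsilon>_def laurent_of_in_span)
    ultimately show "\<exists>\<upsilon>. pade_solution \<mu> n \<xi> \<upsilon>" using span iff by blast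
  qed
qed

text \<open>The normalization already contains the vanishing moments that yield \<upsilon>, so for
  families in the spans it implies solvability.\<close>

lemma normalized_pade_solution_iff:
  "(\<exists>\<upsilon>. pade_solution \<mu> n \<xi> \<upsilon>) \<and> type_I_normalized \<mu> n \<xi> \<longleftrightarrow> type_I_vector \<mu> n \<xi>"
proof -
  have "in_spans \<xi> \<and> type_I_normalized \<mu> n \<xi> \<longleftrightarrow> type_I_vector \<mu> n \<xi>"
    by (simp add: type_I_vector_def in_spans_def)
  moreover have "total_moment \<xi> k = 0"
    if "type_I_vector \<mu> n \<xi>" "k \<in> {- half_size n + 1..half_size n - 1}" for k
    using that unfolding type_I_vector_iff by auto
  ultimately show ?thesis unfolding ex_pade_solution_iff by blast
qed

section \<open>Uniqueness and the kernel of the moment matrix\<close>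

lemma laurent_family:
  fixes a :: "'r \<times> int \<Rightarrow> complex"
  obtains \<xi> where "in_spans \<xi>"
    "\<And>j i. i \<in> exponents j \<Longrightarrow> Poly_Mapping.lookup (\<xi> j) i = a (j, i)"
    "\<And>k. total_moment \<xi> k = (\<Sum>x\<in>unknowns. moment_matrix k x * a x)"
proof
  let ?\<xi> = "\<lambda>j. laurent_of (exponents j) (\<lambda>i. a (j, i))"
  show "in_spans ?\<xi>" by (simp add: in_spans_def laurent_of_in_span)
  show lookup: "Poly_Mapping.lookup (?\<xi> j) i = a (j, i)" if "i \<in> exponents j" for j i
    using that by (simp add: lookup_laurent_of)
  show "total_moment ?\<xi> k = (\<Sum>x\<in>unknowns. moment_matrix k x * a x)" for k
    unfolding total_moment_def by (rule sum.cong) (auto simp: lookup)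
qed

text \<open>The coefficients of \<open>\<xi> - c * \<eta>\<close> form a kernel vector. Taking
  \<open>c = 1\<close> gives uniqueness, a general \<open>c\<close> gives proportionality.\<close>

lemma in_spans_eq_multiple:
  assumes "trivial_kernel equations unknowns moment_matrix" "in_spans \<xi>" "in_spans \<eta>"
    and "\<And>k. k \<in> equations \<Longrightarrow> total_moment \<xi> k = c * total_moment \<eta> k"
  shows "Poly_Mapping.lookup (\<xi> j) i = c * Poly_Mapping.lookup (\<eta> j) i"
proof (cases "i \<in> exponents j")
  case True
  let ?a = "\<lambda>(j, i). Poly_Mapping.lookup (\<xi> j) i - c * Poly_Mapping.lookup (\<eta> j) i"
  have "(\<Sum>x\<in>unknowns. moment_matrix k x * ?a x) = 0" if "k \<in> equations" for k
    using assms(4)[OF that]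
    by (simp add: total_moment_def case_prod_unfold right_diff_distrib sum_subtractf
        sum_distrib_left mult.left_commute)
  from trivial_kernelD[OF assms(1) this, of "(j, i)"] True show ?thesis by simp
next
  case False
  then have "Poly_Mapping.lookup (\<xi> j) i = 0" "Poly_Mapping.lookup (\<eta> j) i = 0"
    using assms(2,3) laurent_spanD[of _ "exponents j" i] unfolding in_spans_def by blast+
  then show ?thesis by simp
qed

text \<open>A trivial kernel gives existence through squareness; conversely, a kernel vector added
  to the unique type I vector would yield another one.\<close>

lemma unique_type_I_vector_iff:
  "(\<exists>!\<xi>. type_I_vector \<mu> n \<xi>) \<longleftrightarrow> trivial_kernel equations unknowns moment_matrix"
proof
  assume kernel: "trivial_kernel equations unknowns moment_matrix"
  obtain a where a: "\<And>k. k \<in> equations \<Longrightarrow>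
      (\<Sum>x\<in>unknowns. moment_matrix k x * a x) = (if k = - half_size n then 1 else 0)"
    using trivial_kernel_imp_solvable[OF _ finite_unknowns card_equations_eq_card_unknowns kernel,
        of "\<lambda>k. if k = - half_size n then 1 else 0"] by blast
  obtain \<xi> where "in_spans \<xi>" "\<And>k. total_moment \<xi> k = (\<Sum>x\<in>unknowns. moment_matrix k x * a x)"
    by (rule laurent_family[of a]) blast
  then have "type_I_vector \<mu> n \<xi>" by (simp add: type_I_vector_iff a)
  moreover have "\<eta> = \<xi>" if "type_I_vector \<mu> n \<eta>" "type_I_vector \<mu> n \<xi>" for \<eta> \<xi>
  proof -
    have "Poly_Mapping.lookup (\<eta> j) i = 1 * Poly_Mapping.lookup (\<xi> j) i" for j i
      using that unfolding type_I_vector_iff by (intro in_spans_eq_multiple[OF kernel]) auto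
    then show ?thesis by (intro ext poly_mapping_eqI) simp
  qed
  ultimately show "\<exists>!\<xi>. type_I_vector \<mu> n \<xi>" by blast
next
  assume "\<exists>!\<xi>. type_I_vector \<mu> n \<xi>"
  then obtain \<xi> where \<xi>: "type_I_vector \<mu> n \<xi>" and unique: "\<And>\<eta>. type_I_vector \<mu> n \<eta> \<Longrightarrow> \<eta> = \<xi>"
    by blast
  show "trivial_kernel equations unknowns moment_matrix"
    unfolding trivial_kernel_def
  proof (intro allI impI ballI)
    fix a x
    assume a: "\<forall>k\<in>equations. (\<Sum>x\<in>unknowns. moment_matrix k x * a x) = 0" and x: "x \<in> unknowns"
    obtain \<eta> where \<eta>: "in_spans \<eta>"
      "\<And>j i. i \<in> exponents j \<Longrightarrow> Poly_Mapping.lookup (\<eta> j) i = Poly_Mapping.lookup (\<xi> j) i + a (j, i)"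
      "\<And>k. total_moment \<eta> k
        = (\<Sum>(j, i)\<in>unknowns. moment_matrix k (j, i) * (Poly_Mapping.lookup (\<xi> j) i + a (j, i)))"
      using laurent_family[of "\<lambda>(j, i). Poly_Mapping.lookup (\<xi> j) i + a (j, i)"]
      by (auto simp: case_prod_unfold)
    have "total_moment \<eta> k = total_moment \<xi> k" if "k \<in> equations" for k
      unfolding \<eta>(3) unfolding total_moment_def
      using a that by (simp add: case_prod_unfold distrib_left sum.distrib)
    then have "\<eta> = \<xi>" using \<eta>(1) \<xi> by (intro unique) (simp add: type_I_vector_iff)
    then show "a x = 0" using \<eta>(2)[of "snd x" "fst x"] x by (auto simp: mem_Sigma_iff)
  qed
qed

text \<open>With the top coefficient of \<phi> fixed at 1, its column moves to the right-hand side
  \<open>rhs\<close> and leaves a square system whose matrix is the adjoint of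
  \<open>moment_matrix\<close>.\<close>

lemma phi_normal_iff: "phi_normal \<mu> n \<longleftrightarrow> trivial_kernel equations unknowns moment_matrix"
proof -
  let ?s = "half_size n"
  let ?P = "\<lambda>x k. cnj (moment_matrix k x)"
  define rhs where "rhs x = - cnj (moment_matrix ?s x)" for x
  define ok where "ok \<phi> \<longleftrightarrow> \<phi> \<in> laurent_span {- ?s..?s} \<and> Poly_Mapping.lookup \<phi> ?s = 1 \<and>
      (\<forall>x\<in>unknowns. (\<Sum>k\<in>equations. ?P x k * Poly_Mapping.lookup \<phi> k) = rhs x)" for \<phi>
  have okD: "(\<Sum>k\<in>equations. ?P x k * Poly_Mapping.lookup \<phi> k) = rhs x"
    if "ok \<phi>" "x \<in> unknowns" for \<phi> x
    using that unfolding ok_def by blast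
  \<comment> \<open>The conjugate of the matrix entry at row \<open>m\<close> and column
    \<open>(j, k)\<close> is \<open>moment (\<mu> j) (m - k)\<close>, the contribution of
    \<open>z powi m\<close> to the integral.\<close>
  have cond: "(LINT z|\<mu> j. laurent_eval \<phi> z * z powi (- k)) = 0 \<longleftrightarrow>
      (\<Sum>m\<in>equations. ?P (j, k) m * Poly_Mapping.lookup \<phi> m) = rhs (j, k)"
    if \<phi>: "\<phi> \<in> laurent_span {- ?s..?s}" "Poly_Mapping.lookup \<phi> ?s = 1" for \<phi> j k
  proof -
    have "{- ?s..?s} = insert ?s equations" using half_size_pos by auto
    then have "(LINT z|\<mu> j. laurent_eval \<phi> z * z powi (- k)) = moment (\<mu> j) (?s - k)
        + (\<Sum>m\<in>equations. Poly_Mapping.lookup \<phi> m * moment (\<mu> j) (m - k))"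
      using \<phi> by (simp add: circle_measure.integral_laurent_eval[OF circle _ \<phi>(1)])
    then show ?thesis
      by (simp add: moment_matrix_def rhs_def circle_measure.cnj_moment[OF circle] mult.commute eq_neg_iff_add_eq_0
          add.commute)
  qed
  have normal: "phi_normal \<mu> n \<longleftrightarrow> (\<exists>!\<phi>. ok \<phi>)"
    unfolding phi_normal_def
    by (rule arg_cong[where f = Ex1], rule ext) (auto simp: ok_def cond)
  have family: "\<exists>\<phi>. \<phi> \<in> laurent_span {- ?s..?s} \<and> Poly_Mapping.lookup \<phi> ?s = 1 \<and>
      (\<forall>k\<in>equations. Poly_Mapping.lookup \<phi> k = \<kappa> k)" for \<kappa>
    using half_size_pos
    by (intro exI[of _ "laurent_of {- ?s..?s} (\<lambda>k. if k = ?s then 1 else \<kappa> k)"])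
      (auto simp: laurent_of_in_span lookup_laurent_of)
  have "(\<exists>!\<phi>. ok \<phi>) \<longleftrightarrow> trivial_kernel unknowns equations ?P"
  proof
    assume kernel: "trivial_kernel unknowns equations ?P"
    obtain \<kappa> where \<kappa>: "\<And>x. x \<in> unknowns \<Longrightarrow> (\<Sum>k\<in>equations. ?P x k * \<kappa> k) = rhs x"
      using trivial_kernel_imp_solvable[OF finite_unknowns _ card_equations_eq_card_unknowns[symmetric] kernel,
          of rhs] by blast
    obtain \<phi> where \<phi>: "\<phi> \<in> laurent_span {- ?s..?s}" "Poly_Mapping.lookup \<phi> ?s = 1"
      "\<And>k. k \<in> equations \<Longrightarrow> Poly_Mapping.lookup \<phi> k = \<kappa> k"
      using family by blast
    have "(\<Sum>k\<in>equations. ?P x k * Poly_Mapping.lookup \<phi> k) = (\<Sum>k\<in>equations. ?P x k * \<kappa> k)" for x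
      by (rule sum.cong) (simp_all add: \<phi>(3))
    then have "ok \<phi>" using \<phi> \<kappa> by (simp add: ok_def)
    moreover have "\<psi> = \<phi>" if "ok \<phi>" "ok \<psi>" for \<phi> \<psi>
    proof (rule laurent_span_eqI)
      fix k assume "k \<in> {- ?s..?s}"
      then consider "k = ?s" | "k \<in> equations" by force
      then show "Poly_Mapping.lookup \<psi> k = Poly_Mapping.lookup \<phi> k"
      proof cases
        case 2
        have "(\<Sum>k\<in>equations. ?P x k * (Poly_Mapping.lookup \<psi> k - Poly_Mapping.lookup \<phi> k)) = 0"
          if "x \<in> unknowns" for x
        proof -
          have "(\<Sum>k\<in>equations. ?P x k * Poly_Mapping.lookup \<psi> k)
              = (\<Sum>k\<in>equations. ?P x k * Poly_Mapping.lookup \<phi> k)"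
            by (simp only: okD[OF \<open>ok \<phi>\<close> that] okD[OF \<open>ok \<psi>\<close> that])
          then show ?thesis by (simp add: right_diff_distrib sum_subtractf)
        qed
        from trivial_kernelD[OF kernel this 2] show ?thesis by simp
      qed (use that in \<open>simp add: ok_def\<close>)
    qed (use that in \<open>simp_all add: ok_def\<close>)
    ultimately show "\<exists>!\<phi>. ok \<phi>" by blast
  next
    assume "\<exists>!\<phi>. ok \<phi>"
    then obtain \<phi> where \<phi>: "ok \<phi>" and unique: "\<And>\<psi>. ok \<psi> \<Longrightarrow> \<psi> = \<phi>" by blast
    show "trivial_kernel unknowns equations ?P"
      unfolding trivial_kernel_def
    proof (intro allI impI ballI)
      fix a k
      assume a: "\<forall>x\<in>unknowns. (\<Sum>k\<in>equations. ?P x k * a k) = 0" and k: "k \<in> equations"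
      \<comment> \<open>Perturbing \<phi> by the kernel vector below the top coefficient gives
        another solution.\<close>
      obtain \<psi> where \<psi>: "\<psi> \<in> laurent_span {- ?s..?s}" "Poly_Mapping.lookup \<psi> ?s = 1"
        "\<And>k. k \<in> equations \<Longrightarrow> Poly_Mapping.lookup \<psi> k = Poly_Mapping.lookup \<phi> k + a k"
        using family[of "\<lambda>k. Poly_Mapping.lookup \<phi> k + a k"] by blast
      have "(\<Sum>k\<in>equations. ?P x k * Poly_Mapping.lookup \<psi> k)
          = (\<Sum>k\<in>equations. ?P x k * (Poly_Mapping.lookup \<phi> k + a k))" for x
        by (rule sum.cong) (simp_all add: \<psi>(3))
      then have "ok \<psi>"
        using \<phi> \<psi>(1,2) a by (simp add: ok_def distrib_left sum.distrib)
      then show "a k = 0" using unique \<psi>(3)[OF k] by fastforce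
    qed
  qed
  then show ?thesis
    unfolding normal
    using trivial_kernel_cnj_transpose_iff[OF _ finite_unknowns card_equations_eq_card_unknowns,
        of moment_matrix] by simp
qed

lemma pade_solution_multiple_of_type_I_vector:
  assumes "phi_normal \<mu> n" "type_I_vector \<mu> n \<eta>" "pade_solution \<mu> n \<xi> \<upsilon>"
  shows "\<exists>c. \<forall>j k. Poly_Mapping.lookup (\<xi> j) k = c * Poly_Mapping.lookup (\<eta> j) k"
proof -
  have \<xi>: "in_spans \<xi>" "\<And>k. k \<in> {- half_size n + 1..half_size n - 1} \<Longrightarrow> total_moment \<xi> k = 0"
    using ex_pade_solution_iff assms(3) by blast+
  \<comment> \<open>Both sides vanish at every equation but the lowest, where \<eta> has moment 1;
    the constant is therefore the lowest moment of \<xi>.\<close>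
  have "total_moment \<xi> k = total_moment \<xi> (- half_size n) * total_moment \<eta> k" if "k \<in> equations" for k
    using that assms(2) \<xi>(2)[of k] by (auto simp: type_I_vector_iff)
  moreover have "trivial_kernel equations unknowns moment_matrix" "in_spans \<eta>"
    using assms(1,2) by (simp_all only: phi_normal_iff type_I_vector_iff)
  ultimately show ?thesis using in_spans_eq_multiple[OF _ \<xi>(1)] by blast
qed

end

theorem corollary7p2:
  fixes \<mu> :: "'r::finite \<Rightarrow> complex measure" and n :: "'r \<Rightarrow> nat"
  assumes "\<And>j. prob_space (\<mu> j)"
    and "\<And>j. sets (\<mu> j) = sets (restrict_space borel (sphere 0 1))"
    and "\<And>j. even (n j)"
    and "\<exists>j. n j \<noteq> 0"
  shows "((\<exists>!\<xi>. (\<exists>\<upsilon>. pade_solution \<mu> n \<xi> \<upsilon>) \<and> type_I_normalized \<mu> n \<xi>) \<longleftrightarrow> phi_normal \<mu> n) \<and>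
    (phi_normal \<mu> n \<longrightarrow>
      (\<exists>!\<xi>. type_I_vector \<mu> n \<xi>) \<and>
      (\<forall>\<eta> \<xi> \<upsilon>. type_I_vector \<mu> n \<eta> \<longrightarrow> pade_solution \<mu> n \<xi> \<upsilon> \<longrightarrow>
        (\<exists>c. \<forall>j k. Poly_Mapping.lookup (\<xi> j) k = c * Poly_Mapping.lookup (\<eta> j) k)))"
proof -
  interpret circle_system \<mu> n
    using assms by (auto intro!: circle_system.intro circle_measure.intro circle_measure_axioms.intro)
  show ?thesis
    unfolding normalized_pade_solution_iff
    using pade_solution_multiple_of_type_I_vector
    by (simp only: unique_type_I_vector_iff phi_normal_iff) blast
qed

end
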